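(* Let $n\in\mathbb{N}$, $s\in\{0,1,\ldots,n-1\}$, let $P,Q$ be finite index sets, and let $f\in C^2(\mathbb{R}^n,\mathbb{R})$, $h=(h_p,p\in P)\in C^2(\mathbb{R}^n,\mathbb{R}^{|P|})$, $g=(g_q,q\in Q)\in C^2(\mathbb{R}^n,\mathbb{R}^{|Q|})$. Let $c\in\mathbb{R}^n$ have positive and pairwise different components, and let $0<\varepsilon\le\frac{1}{n-s}$. If $(\bar x,\bar y)$ is a T-stationary point of $\mathcal{R}(c,\varepsilon)$, then $\bar x$ is an M-stationary point of CCOP. If $(\bar x,\bar y)$ is additionally nondegenerate with T-index $m$ and satisfies NDT5, then $\bar x$ is also nondegenerate with M-index $m$.
   Context: CCOP is the problem $\min_x f(x)$ s.t. $h(x)=0$, $g(x)\ge 0$, $\|x\|_0\le s$, where $\|x\|_0=|\{i\in\{1,\ldots,n\}: x_i\neq 0\}|$. The regularized continuous reformulation is $$\mathcal{R}(c,\varepsilon):\ \min_{x,y\in\mathbb{R}^n} f(x)+c^Ty\ \text{ s.t. } h(x)=0,\ g(x)\ge 0,\ \sum_{i=1}^n y_i\ge n-s,\ x_iy_i=0,\ 0\le y_i\le 1+\varepsilon,\ i=1,\ldots,n.$$ Notation: $e_i$ is the $i$-th coordinate vector of $\mathbb{R}^n$ and $e=(1,\ldots,1)^T\in\mathbb{R}^n$. Put $Q_0(\bar x)=\{q\in Q: g_q(\bar x)=0\}$ and $I_0(\bar x)=\{i:\bar x_i=0\}$. For $(\bar x,\bar y)$ feasible for $\mathcal{R}(c,\varepsilon)$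 put $a_{00}=\{i:\bar x_i=0,\bar y_i=0\}$, $a_{01}=\{i:\bar x_i=0,\bar y_i>0\}$, $a_{10}=\{i:\bar x_i\ne0,\bar y_i=0\}$, $\mathcal{E}(\bar y)=\{i:\bar y_i=1+\varepsilon\}$. For a symmetric matrix $A$ and a linear subspace $T$, $A\restriction_T$ denotes $V^TAV$, where the columns of $V$ form a basis of $T$ (nonsingularity and the number of negative eigenvalues do not depend on the basis). **CCOP notions.** A CCOP feasible point $\bar x$ is M-stationary if there exist multipliers $\bar\lambda_p$ ($p\in P$), $\bar\mu_q$ ($q\in Q_0(\bar x)$), $\bar\gamma_i$ ($i\in I_0(\bar x)$) with $\nabla f(\bar x)=\sum_{p\in P}\bar\lambda_p\nabla h_p(\bar x)+\sum_{q\in Q_0(\bar x)}\bar\mu_q\nabla g_q(\bar x)+\sum_{i\in I_0(\bar x)}\bar\gamma_ie_i$ and $\bar\mu_q\ge0$ for all $q\in Q_0(\bar x)$. CC-LICQ at $\bar x$ means that $\nabla h_p(\bar x)$, $p\in P$; $\nabla g_q(\bar x)$, $q\in Q_0(\bar x)$; $e_i$, $i\in I_0(\bar x)$, are linearly independent. Let $L(x)=f(x)-\sum_{p\in P}\bar\lambda_ph_p(x)-\sum_{q\in Q_0(\bar x)}\bar\mu_qg_q(x)-\sum_{i\in I_0(\bar x)}\bar\gamma_ix_i$ and $\mathcal{T}_{\bar x}=\{\xi\in\mathbb{R}^n: Dh_p(\bar x)\xi=0\ (p\in P),\ Dg_q(\bar x)\xi=0\ (q\in Q_0(\bar x)),\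 \xi_i=0\ (i\in I_0(\bar x))\}$. An M-stationary point $\bar x$ is nondegenerate if: (NDM1) CC-LICQ holds at $\bar x$; (NDM2) $\bar\mu_q>0$ for all $q\in Q_0(\bar x)$; (NDM3) if $\|\bar x\|_0<s$ then $\bar\gamma_i\ne0$ for all $i\in I_0(\bar x)$; (NDM4) $D^2L(\bar x)\restriction_{\mathcal{T}_{\bar x}}$ is nonsingular. The M-index of a nondegenerate M-stationary point $\bar x$ is $QI+SI$, where $QI$ is the number of negative eigenvalues of $D^2L(\bar x)\restriction_{\mathcal{T}_{\bar x}}$ and $SI=s-\|\bar x\|_0$. **$\mathcal{R}$ notions.** A feasible point $(\bar x,\bar y)$ of $\mathcal{R}(c,\varepsilon)$ is T-stationary if there exist real multipliers $\bar\lambda_p$ ($p\in P$), $\bar\mu_{1,q}$ ($q\in Q_0(\bar x)$), $\bar\mu_{2,i}$ ($i\in\mathcal{E}(\bar y)$), $\bar\mu_3$, $\bar\sigma_{1,i}$ ($i\in a_{01}$), $\bar\sigma_{2,i}$ ($i\in a_{10}$), $\bar\varrho_{1,i},\bar\varrho_{2,i}$ ($i\in a_{00}$) such that $$\begin{pmatrix}\nabla f(\bar x)\\ c\end{pmatrix}=\sum_{p\in P}\bar\lambda_p\begin{pmatrix}\nabla h_p(\bar x)\\ 0\end{pmatrix}+\sum_{q\in Q_0(\bar x)}\bar\mu_{1,q}\begin{pmatrix}\nabla g_q(\bar x)\\ 0\end{pmatrix}-\sum_{i\in\mathcal{E}(\bar y)}\bar\mu_{2,i}\begin{pmatrix}0\\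 e_i\end{pmatrix}+\bar\mu_3\begin{pmatrix}0\\ e\end{pmatrix}+\sum_{i\in a_{01}}\bar\sigma_{1,i}\begin{pmatrix}e_i\\ 0\end{pmatrix}+\sum_{i\in a_{10}}\bar\sigma_{2,i}\begin{pmatrix}0\\ e_i\end{pmatrix}+\sum_{i\in a_{00}}\left(\bar\varrho_{1,i}\begin{pmatrix}e_i\\ 0\end{pmatrix}+\bar\varrho_{2,i}\begin{pmatrix}0\\ e_i\end{pmatrix}\right),$$ $\bar\mu_{1,q}\ge0$ ($q\in Q_0(\bar x)$), $\bar\mu_{2,i}\ge0$ ($i\in\mathcal{E}(\bar y)$), $\bar\mu_3\ge0$, $\bar\mu_3\left(\sum_{i=1}^n\bar y_i-(n-s)\right)=0$, and, for all $i\in a_{00}$, $\bar\varrho_{1,i}=0$ or $\bar\varrho_{2,i}\le0$. MPOC-LICQ at $(\bar x,\bar y)$ means that the following vectors of $\mathbb{R}^{2n}$ (as a family) are linearly independent: $(\nabla h_p(\bar x),0)$, $p\in P$; $(\nabla g_q(\bar x),0)$, $q\in Q_0(\bar x)$; $(0,e_i)$, $i\in\mathcal{E}(\bar y)$; $(0,e)$ if $\sum_i\bar y_i=n-s$; $(e_i,0)$, $i\in a_{01}\cup a_{00}$; $(0,e_i)$, $i\in a_{10}\cup a_{00}$. Let $$L^{\mathcal{R}}(x,y)=f(x)+c^Ty-\sum_{p}\bar\lambda_ph_p(x)-\sum_{q\in Q_0(\bar x)}\bar\mu_{1,q}g_q(x)+\sum_{i\in\mathcal{E}(\bar y)}\bar\mu_{2,i}(y_i-(1+\varepsilon))-\bar\mu_3\Big(\sum_{i=1}^ny_i-(n-s)\Big)-\sum_{i\in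 a_{01}}\bar\sigma_{1,i}x_i-\sum_{i\in a_{10}}\bar\sigma_{2,i}y_i-\sum_{i\in a_{00}}(\bar\varrho_{1,i}x_i+\bar\varrho_{2,i}y_i)$$ and let $\mathcal{T}^{\mathcal{R}}_{(\bar x,\bar y)}$ be the set of $\xi\in\mathbb{R}^{2n}$ with $(Dh_p(\bar x),0)\xi=0$ ($p\in P$), $(Dg_q(\bar x),0)\xi=0$ ($q\in Q_0(\bar x)$), $(0,e_i)\xi=0$ ($i\in\mathcal{E}(\bar y)$), $(0,e)\xi=0$ if $\sum_i\bar y_i=n-s$, $(e_i,0)\xi=0$ ($i\in a_{00}\cup a_{01}$), $(0,e_i)\xi=0$ ($i\in a_{00}\cup a_{10}$). A T-stationary point $(\bar x,\bar y)$ is nondegenerate if: (NDT1) MPOC-LICQ holds at $(\bar x,\bar y)$; (NDT2) $\bar\mu_{1,q}>0$ for all $q\in Q_0(\bar x)$, $\bar\mu_{2,i}>0$ for all $i\in\mathcal{E}(\bar y)$, and $\bar\mu_3>0$ if $\sum_i\bar y_i=n-s$; (NDT3) $\bar\varrho_{1,i}\ne0$ and $\bar\varrho_{2,i}<0$ for all $i\in a_{00}$; (NDT4) $D^2L^{\mathcal{R}}(\bar x,\bar y)\restriction_{\mathcal{T}^{\mathcal{R}}_{(\bar x,\bar y)}}$ is nonsingular. A nondegenerate T-stationary point satisfies NDT5 if: whenever $a_{00}\ne\emptyset$, then $\bar\sigma_{1,i}\ne0$ for all $i\in a_{01}$. The T-index of a nondegenerate T-stationary point is $QI+BI$, where $QI$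 is the number of negative eigenvalues of $D^2L^{\mathcal{R}}(\bar x,\bar y)\restriction_{\mathcal{T}^{\mathcal{R}}_{(\bar x,\bar y)}}$ and $BI=|a_{00}|$. (Multipliers are unique under CC-LICQ, respectively MPOC-LICQ.) *)

theory Defs
  imports
    "HOL-Analysis.Analysis"
    "Jordan_Normal_Form.Char_Poly"
begin

(* The dollar sign and the bullet denote components and the inner product of HOL-Analysis. *)
no_notation Matrix.vec_index (infixl "$" 100)
no_notation Matrix.scalar_prod (infix "\<bullet>" 70)

section \<open>Derivatives and restricted Hessians\<close>

definition grad :: "('a::euclidean_space \<Rightarrow> real) \<Rightarrow> 'a \<Rightarrow> 'a" where
  "grad f x = (THE D. GDERIV f x :> D)"

definition hess :: "('a::euclidean_space \<Rightarrow> real) \<Rightarrow> 'a \<Rightarrow> 'a \<Rightarrow> 'a" where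
  "hess f x = frechet_derivative (grad f) (at x)"

definition C2 :: "('a::euclidean_space \<Rightarrow> real) \<Rightarrow> bool" where
  "C2 f \<longleftrightarrow> (\<forall>x. f differentiable (at x)) \<and> (\<forall>x. grad f differentiable (at x)) \<and>
            (\<forall>v. continuous_on UNIV (\<lambda>x. hess f x v))"

definition lin_indep_family :: "('i \<Rightarrow> 'a::real_vector) \<Rightarrow> 'i set \<Rightarrow> bool" where
  "lin_indep_family v I \<longleftrightarrow> inj_on v I \<and> independent (v ` I)"

definition basis_list :: "'a::euclidean_space set \<Rightarrow> 'a list \<Rightarrow> bool" where
  "basis_list T vs \<longleftrightarrow> distinct vs \<and> independent (set vs) \<and> span (set vs) = T"

(* The matrix V^T A V, where the columns of V are the entries of vs. *)
definition compression :: "('a::euclidean_space \<Rightarrow> 'a) \<Rightarrow> 'a list \<Rightarrow> real mat" where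
  "compression A vs = Matrix.mat (length vs) (length vs) (\<lambda>(i, j). inner (vs ! i) (A (vs ! j)))"

definition num_neg_eigenvalues :: "real mat \<Rightarrow> nat" where
  "num_neg_eigenvalues M = size (filter_mset (\<lambda>l. l < 0) (proots (char_poly M)))"

(* For self-adjoint A and a subspace T, the two notions below do not depend on the basis
   (in the second case by Sylvester's law of inertia), so the definite description picks out the
   common value. *)
definition nonsingular_on :: "('a::euclidean_space \<Rightarrow> 'a) \<Rightarrow> 'a set \<Rightarrow> bool" where
  "nonsingular_on A T \<longleftrightarrow> (\<forall>vs. basis_list T vs \<longrightarrow> Determinant.det (compression A vs) \<noteq> 0)"

definition quadratic_index :: "('a::euclidean_space \<Rightarrow> 'a) \<Rightarrow> 'a set \<Rightarrow> nat" where
  "quadratic_index A T =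
     (THE k. \<forall>vs. basis_list T vs \<longrightarrow> num_neg_eigenvalues (compression A vs) = k)"

abbreviation coord :: "'n \<Rightarrow> real^'n::finite" where
  "coord i \<equiv> axis i 1"

section \<open>The cardinality-constrained problem\<close>

definition zero_norm :: "real^'n::finite \<Rightarrow> nat" where
  "zero_norm x = card {i. x $ i \<noteq> 0}"

definition Q0 :: "'q set \<Rightarrow> ('q \<Rightarrow> real^'n::finite \<Rightarrow> real) \<Rightarrow> real^'n \<Rightarrow> 'q set" where
  "Q0 Q g x = {q\<in>Q. g q x = 0}"

definition I0 :: "real^'n::finite \<Rightarrow> 'n set" where
  "I0 x = {i. x $ i = 0}"

definition CCOP_feasible ::
  "'p set \<Rightarrow> ('p \<Rightarrow> real^'n::finite \<Rightarrow> real) \<Rightarrow> 'q set \<Rightarrow> ('q \<Rightarrow> real^'n \<Rightarrow> real) \<Rightarrow> nat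
     \<Rightarrow> real^'n \<Rightarrow> bool" where
  "CCOP_feasible P h Q g s x \<longleftrightarrow>
     (\<forall>p\<in>P. h p x = 0) \<and> (\<forall>q\<in>Q. g q x \<ge> 0) \<and> zero_norm x \<le> s"

(* Multipliers are total functions; only their values on the relevant index sets matter. *)
record ('p, 'q, 'n) M_mult =
  lamM :: "'p \<Rightarrow> real"
  muM :: "'q \<Rightarrow> real"
  gamM :: "'n \<Rightarrow> real"

definition is_M_multiplier ::
  "(real^'n::finite \<Rightarrow> real) \<Rightarrow> 'p set \<Rightarrow> ('p \<Rightarrow> real^'n \<Rightarrow> real) \<Rightarrow>
   'q set \<Rightarrow> ('q \<Rightarrow> real^'n \<Rightarrow> real) \<Rightarrow> real^'n \<Rightarrow> ('p, 'q, 'n) M_mult \<Rightarrow> bool" where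
  "is_M_multiplier f P h Q g x M \<longleftrightarrow>
     grad f x = (\<Sum>p\<in>P. lamM M p *\<^sub>R grad (h p) x)
              + (\<Sum>q\<in>Q0 Q g x. muM M q *\<^sub>R grad (g q) x)
              + (\<Sum>i\<in>I0 x. gamM M i *\<^sub>R coord i) \<and>
     (\<forall>q\<in>Q0 Q g x. muM M q \<ge> 0)"

definition M_stationary ::
  "(real^'n::finite \<Rightarrow> real) \<Rightarrow> 'p set \<Rightarrow> ('p \<Rightarrow> real^'n \<Rightarrow> real) \<Rightarrow>
   'q set \<Rightarrow> ('q \<Rightarrow> real^'n \<Rightarrow> real) \<Rightarrow> nat \<Rightarrow> real^'n \<Rightarrow> bool" where
  "M_stationary f P h Q g s x \<longleftrightarrow>
     CCOP_feasible P h Q g s x \<and> (\<exists>M. is_M_multiplier f P h Q g x M)"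

(* Under CC-LICQ the multipliers are unique on the relevant index sets. *)
definition M_multiplier ::
  "(real^'n::finite \<Rightarrow> real) \<Rightarrow> 'p set \<Rightarrow> ('p \<Rightarrow> real^'n \<Rightarrow> real) \<Rightarrow>
   'q set \<Rightarrow> ('q \<Rightarrow> real^'n \<Rightarrow> real) \<Rightarrow> real^'n \<Rightarrow> ('p, 'q, 'n) M_mult" where
  "M_multiplier f P h Q g x = (SOME M. is_M_multiplier f P h Q g x M)"

datatype ('p, 'q, 'n) cc_index = CC_h 'p | CC_g 'q | CC_x 'n

fun cc_gradient ::
  "('p \<Rightarrow> real^'n::finite \<Rightarrow> real) \<Rightarrow> ('q \<Rightarrow> real^'n \<Rightarrow> real) \<Rightarrow> real^'n
     \<Rightarrow> ('p, 'q, 'n) cc_index \<Rightarrow> real^'n" where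
  "cc_gradient h g x (CC_h p) = grad (h p) x"
| "cc_gradient h g x (CC_g q) = grad (g q) x"
| "cc_gradient h g x (CC_x i) = coord i"

definition CC_LICQ ::
  "'p set \<Rightarrow> ('p \<Rightarrow> real^'n::finite \<Rightarrow> real) \<Rightarrow> 'q set \<Rightarrow> ('q \<Rightarrow> real^'n \<Rightarrow> real)
     \<Rightarrow> real^'n \<Rightarrow> bool" where
  "CC_LICQ P h Q g x \<longleftrightarrow>
     lin_indep_family (cc_gradient h g x) (CC_h ` P \<union> CC_g ` Q0 Q g x \<union> CC_x ` I0 x)"

(* In both Lagrangians the first point, the base point, only determines the active index sets. *)
definition M_lagrangian ::
  "(real^'n::finite \<Rightarrow> real) \<Rightarrow> 'p set \<Rightarrow> ('p \<Rightarrow> real^'n \<Rightarrow> real) \<Rightarrow>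
   'q set \<Rightarrow> ('q \<Rightarrow> real^'n \<Rightarrow> real) \<Rightarrow> real^'n \<Rightarrow> ('p, 'q, 'n) M_mult \<Rightarrow> real^'n \<Rightarrow> real" where
  "M_lagrangian f P h Q g xb M x =
     f x - (\<Sum>p\<in>P. lamM M p * h p x) - (\<Sum>q\<in>Q0 Q g xb. muM M q * g q x)
         - (\<Sum>i\<in>I0 xb. gamM M i * x $ i)"

definition M_tangent ::
  "'p set \<Rightarrow> ('p \<Rightarrow> real^'n::finite \<Rightarrow> real) \<Rightarrow> 'q set \<Rightarrow> ('q \<Rightarrow> real^'n \<Rightarrow> real)
     \<Rightarrow> real^'n \<Rightarrow> (real^'n) set" where
  "M_tangent P h Q g x =
     {\<xi>. (\<forall>p\<in>P. frechet_derivative (h p) (at x) \<xi> = 0) \<and>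
         (\<forall>q\<in>Q0 Q g x. frechet_derivative (g q) (at x) \<xi> = 0) \<and> (\<forall>i\<in>I0 x. \<xi> $ i = 0)}"

definition M_hessian ::
  "(real^'n::finite \<Rightarrow> real) \<Rightarrow> 'p set \<Rightarrow> ('p \<Rightarrow> real^'n \<Rightarrow> real) \<Rightarrow>
   'q set \<Rightarrow> ('q \<Rightarrow> real^'n \<Rightarrow> real) \<Rightarrow> real^'n \<Rightarrow> real^'n \<Rightarrow> real^'n" where
  "M_hessian f P h Q g x = hess (M_lagrangian f P h Q g x (M_multiplier f P h Q g x)) x"

definition M_nondegenerate ::
  "(real^'n::finite \<Rightarrow> real) \<Rightarrow> 'p set \<Rightarrow> ('p \<Rightarrow> real^'n \<Rightarrow> real) \<Rightarrow>
   'q set \<Rightarrow> ('q \<Rightarrow> real^'n \<Rightarrow> real) \<Rightarrow> nat \<Rightarrow> real^'n \<Rightarrow> bool" where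
  "M_nondegenerate f P h Q g s x \<longleftrightarrow> (let M = M_multiplier f P h Q g x in
     M_stationary f P h Q g s x \<and>
     CC_LICQ P h Q g x \<and>
     (\<forall>q\<in>Q0 Q g x. muM M q > 0) \<and>
     (zero_norm x < s \<longrightarrow> (\<forall>i\<in>I0 x. gamM M i \<noteq> 0)) \<and>
     nonsingular_on (M_hessian f P h Q g x) (M_tangent P h Q g x))"

definition M_index ::
  "(real^'n::finite \<Rightarrow> real) \<Rightarrow> 'p set \<Rightarrow> ('p \<Rightarrow> real^'n \<Rightarrow> real) \<Rightarrow>
   'q set \<Rightarrow> ('q \<Rightarrow> real^'n \<Rightarrow> real) \<Rightarrow> nat \<Rightarrow> real^'n \<Rightarrow> nat" where
  "M_index f P h Q g s x =
     quadratic_index (M_hessian f P h Q g x) (M_tangent P h Q g x) + (s - zero_norm x)"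

section \<open>The regularized continuous reformulation\<close>

definition a00 :: "real^'n::finite \<Rightarrow> real^'n \<Rightarrow> 'n set" where
  "a00 x y = {i. x $ i = 0 \<and> y $ i = 0}"

definition a01 :: "real^'n::finite \<Rightarrow> real^'n \<Rightarrow> 'n set" where
  "a01 x y = {i. x $ i = 0 \<and> y $ i > 0}"

definition a10 :: "real^'n::finite \<Rightarrow> real^'n \<Rightarrow> 'n set" where
  "a10 x y = {i. x $ i \<noteq> 0 \<and> y $ i = 0}"

definition upper_active :: "real \<Rightarrow> real^'n::finite \<Rightarrow> 'n set" where
  "upper_active \<epsilon> y = {i. y $ i = 1 + \<epsilon>}"

definition sum_slack :: "nat \<Rightarrow> real^'n::finite \<Rightarrow> real" where
  "sum_slack s y = (\<Sum>i\<in>UNIV. y $ i) - (real CARD('n) - real s)"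

definition R_feasible ::
  "'p set \<Rightarrow> ('p \<Rightarrow> real^'n::finite \<Rightarrow> real) \<Rightarrow> 'q set \<Rightarrow> ('q \<Rightarrow> real^'n \<Rightarrow> real) \<Rightarrow> nat \<Rightarrow> real
     \<Rightarrow> real^'n \<Rightarrow> real^'n \<Rightarrow> bool" where
  "R_feasible P h Q g s \<epsilon> x y \<longleftrightarrow>
     (\<forall>p\<in>P. h p x = 0) \<and> (\<forall>q\<in>Q. g q x \<ge> 0) \<and>
     (\<Sum>i\<in>UNIV. y $ i) \<ge> real CARD('n) - real s \<and>
     (\<forall>i. x $ i * y $ i = 0 \<and> 0 \<le> y $ i \<and> y $ i \<le> 1 + \<epsilon>)"

record ('p, 'q, 'n) T_mult =
  lamT :: "'p \<Rightarrow> real"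
  mu1 :: "'q \<Rightarrow> real"
  mu2 :: "'n \<Rightarrow> real"
  mu3 :: real
  sig1 :: "'n \<Rightarrow> real"
  sig2 :: "'n \<Rightarrow> real"
  rho1 :: "'n \<Rightarrow> real"
  rho2 :: "'n \<Rightarrow> real"

definition is_T_multiplier ::
  "(real^'n::finite \<Rightarrow> real) \<Rightarrow> 'p set \<Rightarrow> ('p \<Rightarrow> real^'n \<Rightarrow> real) \<Rightarrow>
   'q set \<Rightarrow> ('q \<Rightarrow> real^'n \<Rightarrow> real) \<Rightarrow> nat \<Rightarrow> real^'n \<Rightarrow> real \<Rightarrow> real^'n \<Rightarrow> real^'n
     \<Rightarrow> ('p, 'q, 'n) T_mult \<Rightarrow> bool" where
  "is_T_multiplier f P h Q g s c \<epsilon> x y M \<longleftrightarrow>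
     (grad f x, c) =
         (\<Sum>p\<in>P. lamT M p *\<^sub>R (grad (h p) x, 0))
       + (\<Sum>q\<in>Q0 Q g x. mu1 M q *\<^sub>R (grad (g q) x, 0))
       - (\<Sum>i\<in>upper_active \<epsilon> y. mu2 M i *\<^sub>R (0, coord i))
       + mu3 M *\<^sub>R (0, 1)
       + (\<Sum>i\<in>a01 x y. sig1 M i *\<^sub>R (coord i, 0))
       + (\<Sum>i\<in>a10 x y. sig2 M i *\<^sub>R (0, coord i))
       + (\<Sum>i\<in>a00 x y. rho1 M i *\<^sub>R (coord i, 0) + rho2 M i *\<^sub>R (0, coord i)) \<and>
     (\<forall>q\<in>Q0 Q g x. mu1 M q \<ge> 0) \<and>
     (\<forall>i\<in>upper_active \<epsilon> y. mu2 M i \<ge> 0) \<and>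
     mu3 M \<ge> 0 \<and> mu3 M * sum_slack s y = 0 \<and>
     (\<forall>i\<in>a00 x y. rho1 M i = 0 \<or> rho2 M i \<le> 0)"

definition T_stationary ::
  "(real^'n::finite \<Rightarrow> real) \<Rightarrow> 'p set \<Rightarrow> ('p \<Rightarrow> real^'n \<Rightarrow> real) \<Rightarrow>
   'q set \<Rightarrow> ('q \<Rightarrow> real^'n \<Rightarrow> real) \<Rightarrow> nat \<Rightarrow> real^'n \<Rightarrow> real \<Rightarrow> real^'n \<Rightarrow> real^'n \<Rightarrow> bool" where
  "T_stationary f P h Q g s c \<epsilon> x y \<longleftrightarrow>
     R_feasible P h Q g s \<epsilon> x y \<and> (\<exists>M. is_T_multiplier f P h Q g s c \<epsilon> x y M)"

(* Under MPOC-LICQ the multipliers are unique on the relevant index sets. *)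
definition T_multiplier ::
  "(real^'n::finite \<Rightarrow> real) \<Rightarrow> 'p set \<Rightarrow> ('p \<Rightarrow> real^'n \<Rightarrow> real) \<Rightarrow>
   'q set \<Rightarrow> ('q \<Rightarrow> real^'n \<Rightarrow> real) \<Rightarrow> nat \<Rightarrow> real^'n \<Rightarrow> real \<Rightarrow> real^'n \<Rightarrow> real^'n
     \<Rightarrow> ('p, 'q, 'n) T_mult" where
  "T_multiplier f P h Q g s c \<epsilon> x y = (SOME M. is_T_multiplier f P h Q g s c \<epsilon> x y M)"

datatype ('p, 'q, 'n) mpoc_index =
  MPOC_h 'p | MPOC_g 'q | MPOC_upper 'n | MPOC_sum | MPOC_x 'n | MPOC_y 'n

fun mpoc_gradient ::
  "('p \<Rightarrow> real^'n::finite \<Rightarrow> real) \<Rightarrow> ('q \<Rightarrow> real^'n \<Rightarrow> real) \<Rightarrow> real^'n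
     \<Rightarrow> ('p, 'q, 'n) mpoc_index \<Rightarrow> (real^'n) \<times> (real^'n)" where
  "mpoc_gradient h g x (MPOC_h p) = (grad (h p) x, 0)"
| "mpoc_gradient h g x (MPOC_g q) = (grad (g q) x, 0)"
| "mpoc_gradient h g x (MPOC_upper i) = (0, coord i)"
| "mpoc_gradient h g x MPOC_sum = (0, 1)"
| "mpoc_gradient h g x (MPOC_x i) = (coord i, 0)"
| "mpoc_gradient h g x (MPOC_y i) = (0, coord i)"

definition MPOC_LICQ ::
  "'p set \<Rightarrow> ('p \<Rightarrow> real^'n::finite \<Rightarrow> real) \<Rightarrow> 'q set \<Rightarrow> ('q \<Rightarrow> real^'n \<Rightarrow> real) \<Rightarrow> nat \<Rightarrow> real
     \<Rightarrow> real^'n \<Rightarrow> real^'n \<Rightarrow> bool" where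
  "MPOC_LICQ P h Q g s \<epsilon> x y \<longleftrightarrow>
     lin_indep_family (mpoc_gradient h g x)
       (MPOC_h ` P \<union> MPOC_g ` Q0 Q g x \<union> MPOC_upper ` upper_active \<epsilon> y
        \<union> (if sum_slack s y = 0 then {MPOC_sum} else {})
        \<union> MPOC_x ` (a01 x y \<union> a00 x y) \<union> MPOC_y ` (a10 x y \<union> a00 x y))"

definition T_lagrangian ::
  "(real^'n::finite \<Rightarrow> real) \<Rightarrow> 'p set \<Rightarrow> ('p \<Rightarrow> real^'n \<Rightarrow> real) \<Rightarrow>
   'q set \<Rightarrow> ('q \<Rightarrow> real^'n \<Rightarrow> real) \<Rightarrow> nat \<Rightarrow> real^'n \<Rightarrow> real \<Rightarrow> real^'n \<Rightarrow> real^'n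
     \<Rightarrow> ('p, 'q, 'n) T_mult \<Rightarrow> (real^'n) \<times> (real^'n) \<Rightarrow> real" where
  "T_lagrangian f P h Q g s c \<epsilon> xb yb M = (\<lambda>(x, y).
     f x + inner c y
     - (\<Sum>p\<in>P. lamT M p * h p x) - (\<Sum>q\<in>Q0 Q g xb. mu1 M q * g q x)
     + (\<Sum>i\<in>upper_active \<epsilon> yb. mu2 M i * (y $ i - (1 + \<epsilon>)))
     - mu3 M * sum_slack s y
     - (\<Sum>i\<in>a01 xb yb. sig1 M i * x $ i) - (\<Sum>i\<in>a10 xb yb. sig2 M i * y $ i)
     - (\<Sum>i\<in>a00 xb yb. rho1 M i * x $ i + rho2 M i * y $ i))"

definition T_tangent ::
  "'p set \<Rightarrow> ('p \<Rightarrow> real^'n::finite \<Rightarrow> real) \<Rightarrow> 'q set \<Rightarrow> ('q \<Rightarrow> real^'n \<Rightarrow> real) \<Rightarrow> nat \<Rightarrow> real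
     \<Rightarrow> real^'n \<Rightarrow> real^'n \<Rightarrow> ((real^'n) \<times> (real^'n)) set" where
  "T_tangent P h Q g s \<epsilon> x y =
     {(\<xi>, \<eta>). (\<forall>p\<in>P. frechet_derivative (h p) (at x) \<xi> = 0) \<and>
         (\<forall>q\<in>Q0 Q g x. frechet_derivative (g q) (at x) \<xi> = 0) \<and>
         (\<forall>i\<in>upper_active \<epsilon> y. \<eta> $ i = 0) \<and>
         (sum_slack s y = 0 \<longrightarrow> (\<Sum>i\<in>UNIV. \<eta> $ i) = 0) \<and>
         (\<forall>i\<in>a00 x y \<union> a01 x y. \<xi> $ i = 0) \<and>
         (\<forall>i\<in>a00 x y \<union> a10 x y. \<eta> $ i = 0)}"

definition T_hessian ::
  "(real^'n::finite \<Rightarrow> real) \<Rightarrow> 'p set \<Rightarrow> ('p \<Rightarrow> real^'n \<Rightarrow> real) \<Rightarrow>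
   'q set \<Rightarrow> ('q \<Rightarrow> real^'n \<Rightarrow> real) \<Rightarrow> nat \<Rightarrow> real^'n \<Rightarrow> real \<Rightarrow> real^'n \<Rightarrow> real^'n
     \<Rightarrow> (real^'n) \<times> (real^'n) \<Rightarrow> (real^'n) \<times> (real^'n)" where
  "T_hessian f P h Q g s c \<epsilon> x y =
     hess (T_lagrangian f P h Q g s c \<epsilon> x y (T_multiplier f P h Q g s c \<epsilon> x y)) (x, y)"

definition T_nondegenerate ::
  "(real^'n::finite \<Rightarrow> real) \<Rightarrow> 'p set \<Rightarrow> ('p \<Rightarrow> real^'n \<Rightarrow> real) \<Rightarrow>
   'q set \<Rightarrow> ('q \<Rightarrow> real^'n \<Rightarrow> real) \<Rightarrow> nat \<Rightarrow> real^'n \<Rightarrow> real \<Rightarrow> real^'n \<Rightarrow> real^'n \<Rightarrow> bool" where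
  "T_nondegenerate f P h Q g s c \<epsilon> x y \<longleftrightarrow> (let M = T_multiplier f P h Q g s c \<epsilon> x y in
     T_stationary f P h Q g s c \<epsilon> x y \<and>
     MPOC_LICQ P h Q g s \<epsilon> x y \<and>
     (\<forall>q\<in>Q0 Q g x. mu1 M q > 0) \<and> (\<forall>i\<in>upper_active \<epsilon> y. mu2 M i > 0) \<and>
       (sum_slack s y = 0 \<longrightarrow> mu3 M > 0) \<and>
     (\<forall>i\<in>a00 x y. rho1 M i \<noteq> 0 \<and> rho2 M i < 0) \<and>
     nonsingular_on (T_hessian f P h Q g s c \<epsilon> x y) (T_tangent P h Q g s \<epsilon> x y))"

definition NDT5 ::
  "(real^'n::finite \<Rightarrow> real) \<Rightarrow> 'p set \<Rightarrow> ('p \<Rightarrow> real^'n \<Rightarrow> real) \<Rightarrow>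
   'q set \<Rightarrow> ('q \<Rightarrow> real^'n \<Rightarrow> real) \<Rightarrow> nat \<Rightarrow> real^'n \<Rightarrow> real \<Rightarrow> real^'n \<Rightarrow> real^'n \<Rightarrow> bool" where
  "NDT5 f P h Q g s c \<epsilon> x y \<longleftrightarrow>
     (a00 x y \<noteq> {} \<longrightarrow> (\<forall>i\<in>a01 x y. sig1 (T_multiplier f P h Q g s c \<epsilon> x y) i \<noteq> 0))"

definition T_index ::
  "(real^'n::finite \<Rightarrow> real) \<Rightarrow> 'p set \<Rightarrow> ('p \<Rightarrow> real^'n \<Rightarrow> real) \<Rightarrow>
   'q set \<Rightarrow> ('q \<Rightarrow> real^'n \<Rightarrow> real) \<Rightarrow> nat \<Rightarrow> real^'n \<Rightarrow> real \<Rightarrow> real^'n \<Rightarrow> real^'n \<Rightarrow> nat" where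
  "T_index f P h Q g s c \<epsilon> x y =
     quadratic_index (T_hessian f P h Q g s c \<epsilon> x y) (T_tangent P h Q g s \<epsilon> x y) + card (a00 x y)"

end

theory Submission
  imports Defs
begin

text \<open>
  The \<open>y\<close>-part of the stationarity equation gives \<open>c\<^sub>i = \<mu>\<^sub>3\<close> for \<open>i \<in> a\<^sub>0\<^sub>1\<close> off the upper bound and
  \<open>c\<^sub>i \<le> \<mu>\<^sub>3\<close> on it.  Hence \<open>\<mu>\<^sub>3 > 0\<close>, the cardinality constraint is active, and, the components
  of \<open>c\<close> being different, at most one index of \<open>a\<^sub>0\<^sub>1\<close> is not at the upper bound.  With
  \<open>\<epsilon> \<le> 1 / (n - s)\<close> this leaves exactly one such index and \<open>|a\<^sub>0\<^sub>1| = n - s\<close>, so that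
  \<open>s - \<parallel>x\<parallel>\<^sub>0 = |a\<^sub>0\<^sub>0|\<close> and the tangent space of the reformulation is that of CCOP times \<open>{0}\<close>.
  The Lagrangian of the reformulation is that of CCOP plus an affine function of \<open>y\<close>; therefore both
  quadratic forms have literally the same compressions.
\<close>

section \<open>Linear independence\<close>

text \<open>A relation expressing \<open>a\<close> through \<open>S - {a}\<close> is carried by
  \<open>L\<close> to one among the images. Injectivity on \<open>S\<close> ensures that
  \<open>L a\<close> is not the image of another vector of \<open>S\<close>.\<close>

lemma independent_linear_preimage:
  fixes L :: "'a::real_vector \<Rightarrow> 'b::real_vector"
  assumes "linear L" "inj_on L S" "independent (L ` S)"
  shows "independent S"
proof
  assume "dependent S"
  then obtain a where a: "a \<in> S" "a \<in> span (S - {a})"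
    by (auto simp: dependent_def)
  have "L a \<in> span (L ` (S - {a}))"
    using a(2) linear_span_image[OF assms(1)] by blast
  also have "L ` (S - {a}) = L ` S - {L a}"
    using a(1) assms(2) by (auto simp: inj_on_def)
  finally show False
    using a(1) assms(3) by (auto simp: dependent_def)
qed

lemma lin_indep_family_subset:
  assumes "lin_indep_family v J" "I \<subseteq> J"
  shows "lin_indep_family v I"
  using assms unfolding lin_indep_family_def
  by (meson image_mono independent_mono inj_on_subset)

lemma lin_indep_family_reindex:
  assumes "lin_indep_family v (k ` I)" "inj_on k I"
  shows "lin_indep_family (\<lambda>i. v (k i)) I"
  using assms comp_inj_on[of k I v] unfolding lin_indep_family_def
  by (auto simp: comp_def image_image)

lemma lin_indep_family_linear_preimage:
  assumes "linear L" "lin_indep_family (\<lambda>i. L (v i)) I"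
  shows "lin_indep_family v I"
proof -
  have inj: "inj_on (L \<circ> v) I" and ind: "independent (L ` v ` I)"
    using assms(2) by (auto simp: lin_indep_family_def image_image comp_def)
  have "inj_on v I"
    using inj by (rule inj_on_imageI2)
  moreover have "inj_on L (v ` I)"
    using inj by (rule inj_on_imageI)
  ultimately show ?thesis
    using independent_linear_preimage[OF assms(1) _ ind] by (simp add: lin_indep_family_def)
qed

lemma lin_indep_family_coeff_unique:
  fixes v :: "'i \<Rightarrow> 'a::real_vector"
  assumes "lin_indep_family v I" "finite I"
    and eq: "(\<Sum>i\<in>I. a i *\<^sub>R v i) = (\<Sum>i\<in>I. b i *\<^sub>R v i)" and "i \<in> I"
  shows "a i = b i"
proof -
  have inj: "inj_on v I" and ind: "independent (v ` I)"
    using assms(1) by (auto simp: lin_indep_family_def)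
  let ?u = "\<lambda>w. a (the_inv_into I v w) - b (the_inv_into I v w)"
  have "(\<Sum>w\<in>v ` I. ?u w *\<^sub>R w) = (\<Sum>i\<in>I. (a i - b i) *\<^sub>R v i)"
    using inj by (simp add: sum.reindex the_inv_into_f_f)
  also have "\<dots> = 0"
    using eq by (simp add: scaleR_diff_left sum_subtractf)
  finally have "?u (v i) = 0"
    using \<open>finite I\<close> \<open>i \<in> I\<close>
    by (intro independentD[OF ind _ order_refl, of ?u]) auto
  then show ?thesis
    using inj \<open>i \<in> I\<close> by (simp add: the_inv_into_f_f)
qed

section \<open>Gradients and Hessians\<close>

lemma grad_eqI:
  fixes f :: "'a::euclidean_space \<Rightarrow> real"
  assumes "GDERIV f x :> D"
  shows "grad f x = D"
proof -
  have "E = D" if "GDERIV f x :> E" for E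
  proof -
    have "(\<lambda>h. inner h E) = (\<lambda>h. inner h D)"
      using has_derivative_unique assms that unfolding gderiv_def by blast
    then have "\<forall>h. inner h E = inner h D" by metis
    then show ?thesis
      by (simp add: vector_eq_ldot)
  qed
  with assms show ?thesis
    unfolding grad_def by blast
qed

text \<open>Riesz representation: the derivative \<open>L\<close> is the inner product with the
  adjoint of \<open>L\<close> applied to 1. It turns differentiability into a usable description of
  \<open>grad\<close>.\<close>

lemma GDERIV_grad:
  fixes f :: "'a::euclidean_space \<Rightarrow> real"
  assumes "f differentiable (at x)"
  shows "GDERIV f x :> grad f x"
proof -
  obtain L where L: "(f has_derivative L) (at x)"
    using assms by (auto simp: differentiable_def)
  then have "linear L"
    by (rule has_derivative_linear)
  then have "L = (\<lambda>h. inner h (adjoint L 1))"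
    by (auto simp: adjoint_works)
  with L have "GDERIV f x :> adjoint L 1"
    unfolding gderiv_def by simp
  then show ?thesis
    using grad_eqI by metis
qed

text \<open>The gradient is \<open>(grad F z, a)\<close>. Its second component is constant and its
  first ignores \<open>w\<close>, so differentiating once more leaves only
  \<open>hess F\<close>.\<close>

lemma hess_add_affine_snd:
  fixes F :: "'a::euclidean_space \<Rightarrow> real" and a :: "'b::euclidean_space"
  assumes F: "\<And>z. F differentiable (at z)" and F2: "grad F differentiable (at x)"
  shows "hess (\<lambda>(z, w). F z + (inner a w + b)) (x, y) (v, w) = (hess F x v, 0)"
proof -
  let ?G = "\<lambda>(z, w). F z + (inner a w + b)"
  have D: "(F has_derivative (\<lambda>h. inner h (grad F z))) (at z)" for z
    using GDERIV_grad[OF F] by (simp add: gderiv_def)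
  have D': "((\<lambda>p. F (fst p)) has_derivative (\<lambda>k. inner (fst k) (grad F (fst p)))) (at p)"
    for p :: "'a \<times> 'b"
    by (rule has_derivative_compose[OF has_derivative_fst[OF has_derivative_ident] D])
  have "GDERIV ?G p :> (grad F (fst p), a)" for p
    unfolding gderiv_def case_prod_unfold
    by (auto intro!: derivative_eq_intros D' simp: inner_commute)
  then have grad_G: "grad ?G = (\<lambda>p. (grad F (fst p), a))"
    by (auto intro!: grad_eqI)
  have "(grad F has_derivative hess F x) (at x)"
    using F2 by (simp add: hess_def frechet_derivative_works)
  then have "((\<lambda>p. grad F (fst p)) has_derivative (\<lambda>k. hess F x (fst k))) (at (x, y))"
    by (intro has_derivative_compose[OF has_derivative_fst[OF has_derivative_ident]]) simp
  then have "(grad ?G has_derivative (\<lambda>k. (hess F x (fst k), 0))) (at (x, y))"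
    unfolding grad_G by (auto intro!: has_derivative_Pair)
  then show ?thesis
    unfolding hess_def by (simp flip: frechet_derivative_at)
qed

section \<open>Restricted quadratic forms on a product with a null factor\<close>

lemma linear_Pair_zero: "linear (\<lambda>v. (v, 0))"
  by (rule linearI) auto

lemma basis_list_Pair_zero_iff:
  fixes vs :: "'a::euclidean_space list"
  shows "basis_list ((\<lambda>v. (v, 0 :: 'b::euclidean_space)) ` T) (map (\<lambda>v. (v, 0)) vs)
         \<longleftrightarrow> basis_list T vs"
proof -
  let ?L = "\<lambda>v :: 'a. (v, 0 :: 'b)"
  have inj: "inj_on ?L A" for A
    by (auto simp: inj_on_def)
  have "independent (?L ` set vs) \<longleftrightarrow> independent (set vs)"
    using independent_linear_preimage[OF linear_Pair_zero inj]
      linear_independent_injective_image[OF linear_Pair_zero _ inj] by blast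
  moreover have "span (?L ` set vs) = ?L ` T \<longleftrightarrow> span (set vs) = T"
    using linear_span_image[OF linear_Pair_zero] inj_image_eq_iff[OF inj] by metis
  ultimately show ?thesis
    by (simp add: basis_list_def distinct_map inj)
qed

text \<open>Every basis of T \<times> {0} consists of vectors \<open>(v, 0)\<close>, hence comes
  from a basis of T. With \<open>R\<close> arbitrary this applies both to nonsingularity and to the
  predicate under \<open>THE\<close> in \<open>quadratic_index\<close>.\<close>

lemma all_basis_list_Pair_zero:
  fixes T :: "'a::euclidean_space set"
  shows "(\<forall>ws. basis_list ((\<lambda>v. (v, 0 :: 'b::euclidean_space)) ` T) ws \<longrightarrow> R ws) \<longleftrightarrow>
         (\<forall>vs. basis_list T vs \<longrightarrow> R (map (\<lambda>v. (v, 0)) vs))"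
proof -
  have "ws = map (\<lambda>v. (v, 0)) (map fst ws)"
    if "basis_list ((\<lambda>v. (v, 0 :: 'b)) ` T) ws" for ws
  proof -
    have "set ws \<subseteq> (\<lambda>v. (v, 0)) ` T"
      using that span_superset[of "set ws"] by (auto simp: basis_list_def)
    then show ?thesis
      by (induction ws) auto
  qed
  then show ?thesis
    by (metis basis_list_Pair_zero_iff)
qed

lemma compression_Pair_zero:
  fixes vs :: "'a::euclidean_space list"
  assumes "\<And>v. B (v, 0 :: 'b::euclidean_space) = (A v, 0)"
  shows "compression B (map (\<lambda>v. (v, 0)) vs) = compression A vs"
  unfolding compression_def by (auto simp: assms)

lemma nonsingular_on_Pair_zero:
  fixes A :: "'a::euclidean_space \<Rightarrow> 'a"
  assumes "\<And>v. B (v, 0 :: 'b::euclidean_space) = (A v, 0)"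
  shows "nonsingular_on B ((\<lambda>v. (v, 0)) ` T) \<longleftrightarrow> nonsingular_on A T"
  unfolding nonsingular_on_def all_basis_list_Pair_zero
  by (simp only: compression_Pair_zero[of B A, OF assms])

text \<open>The predicates under the two definite descriptions agree for every value of the index,
  hence so do the described numbers.\<close>

lemma quadratic_index_Pair_zero:
  fixes A :: "'a::euclidean_space \<Rightarrow> 'a"
  assumes "\<And>v. B (v, 0 :: 'b::euclidean_space) = (A v, 0)"
  shows "quadratic_index B ((\<lambda>v. (v, 0)) ` T) = quadratic_index A T"
  unfolding quadratic_index_def all_basis_list_Pair_zero
  by (simp only: compression_Pair_zero[of B A, OF assms])

section \<open>Feasible and stationary points of the reformulation\<close>

lemma card_I0_plus_zero_norm:
  fixes x :: "real^'n::finite"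
  shows "card (I0 x) + zero_norm x = CARD('n)"
proof -
  have "card (I0 x \<union> {i. x $ i \<noteq> 0}) = card (I0 x) + zero_norm x"
    unfolding zero_norm_def by (intro card_Un_disjoint) (auto simp: I0_def)
  moreover have "I0 x \<union> {i. x $ i \<noteq> 0} = UNIV"
    by (auto simp: I0_def)
  ultimately show ?thesis
    by simp
qed

text \<open>Since y \<ge> 0 and every product of corresponding components of x and y is 0, the sets
  \<open>a00\<close>, \<open>a01\<close>, \<open>a10\<close> partition the indices, and
  \<open>a01\<close> is the support of y.\<close>

lemma R_feasible_index_sets:
  fixes x y :: "real^'n::finite"
  assumes "R_feasible P h Q g s \<epsilon> x y"
  shows I0_eq_a01_Un_a00: "I0 x = a01 x y \<union> a00 x y"
    and a01_Int_a00: "a01 x y \<inter> a00 x y = {}"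
    and a10_Un_a00: "a10 x y \<union> a00 x y = - a01 x y"
    and sum_a01: "(\<Sum>i\<in>a01 x y. y $ i) = (\<Sum>i\<in>UNIV. y $ i)"
    and upper_active_subset_a01: "\<epsilon> > 0 \<Longrightarrow> upper_active \<epsilon> y \<subseteq> a01 x y"
proof -
  have y: "y $ i \<ge> 0" "x $ i = 0 \<or> y $ i = 0" for i
    using assms by (auto simp: R_feasible_def)
  show "I0 x = a01 x y \<union> a00 x y"
    using y(1) by (fastforce simp: I0_def a01_def a00_def less_le)
  show "a01 x y \<inter> a00 x y = {}"
    by (auto simp: a01_def a00_def)
  show compl: "a10 x y \<union> a00 x y = - a01 x y"
    using y by (fastforce simp: a10_def a01_def a00_def less_le)
  show "(\<Sum>i\<in>a01 x y. y $ i) = (\<Sum>i\<in>UNIV. y $ i)"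
    using compl by (intro sum.mono_neutral_left) (auto simp: a10_def a00_def)
  show "upper_active \<epsilon> y \<subseteq> a01 x y" if "\<epsilon> > 0"
  proof
    fix i assume "i \<in> upper_active \<epsilon> y"
    then have "y $ i > 0"
      using that by (simp add: upper_active_def)
    then show "i \<in> a01 x y"
      using y(2)[of i] by (auto simp: a01_def)
  qed
qed

text \<open>From k < d follows k \<epsilon> < d \<epsilon> \<le> 1, so k (1 + \<epsilon>) < k + 1
  \<le> d.\<close>

lemma eps_bound_product_less:
  fixes d k :: nat
  assumes "0 < \<epsilon>" "\<epsilon> \<le> 1 / real d" "k < d"
  shows "real k * (1 + \<epsilon>) < real d"
proof -
  have "real d * \<epsilon> \<le> 1"
    using assms by (simp add: field_simps)
  moreover have "real k * \<epsilon> < real d * \<epsilon>"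
    using assms by simp
  ultimately have "real k * \<epsilon> < 1"
    by linarith
  moreover have "real k + 1 \<le> real d"
    using assms(3) by linarith
  ultimately show ?thesis
    by (simp add: algebra_simps)
qed

text \<open>Fewer than n - s positive components, each at most 1 + \<epsilon>, would have a sum
  below n - s.\<close>

lemma card_a01_ge:
  fixes x y :: "real^'n::finite"
  assumes feas: "R_feasible P h Q g s \<epsilon> x y" and s: "s < CARD('n)"
    and eps: "0 < \<epsilon>" "\<epsilon> \<le> 1 / (real CARD('n) - real s)"
  shows "CARD('n) - s \<le> card (a01 x y)"
proof (rule ccontr)
  assume "\<not> ?thesis"
  then have "real (card (a01 x y)) * (1 + \<epsilon>) < real (CARD('n) - s)"
    using eps s by (intro eps_bound_product_less) (auto simp: of_nat_diff)
  moreover have "(\<Sum>i\<in>a01 x y. y $ i) \<le> real (card (a01 x y)) * (1 + \<epsilon>)"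
    using feas by (intro sum_bounded_above) (auto simp: R_feasible_def)
  moreover have "real CARD('n) - real s \<le> (\<Sum>i\<in>a01 x y. y $ i)"
    using feas sum_a01[OF feas] by (simp add: R_feasible_def)
  ultimately show False
    using s by (simp add: of_nat_diff)
qed

section \<open>From the reformulation to CCOP: feasibility and multipliers\<close>

lemma CCOP_feasible_if_R_feasible:
  fixes x y :: "real^'n::finite"
  assumes feas: "R_feasible P h Q g s \<epsilon> x y" and s: "s < CARD('n)"
    and eps: "0 < \<epsilon>" "\<epsilon> \<le> 1 / (real CARD('n) - real s)"
  shows "CCOP_feasible P h Q g s x"
proof -
  have "card (a01 x y) \<le> card (I0 x)"
    using I0_eq_a01_Un_a00[OF feas] by (intro card_mono) auto
  then have "zero_norm x \<le> s"
    using card_a01_ge[OF assms] card_I0_plus_zero_norm[of x] s by linarith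
  then show ?thesis
    using feas by (simp add: CCOP_feasible_def R_feasible_def)
qed

text \<open>On the zero set of a feasible x, the sign of y separates \<open>a01\<close> from
  \<open>a00\<close>, and so decides which multiplier of the x-component is taken over.\<close>

definition M_mult_of_T_mult :: "real^'n::finite \<Rightarrow> ('p, 'q, 'n) T_mult \<Rightarrow> ('p, 'q, 'n) M_mult" where
  "M_mult_of_T_mult y M =
     \<lparr>lamM = lamT M, muM = mu1 M, gamM = (\<lambda>i. if y $ i > 0 then sig1 M i else rho1 M i)\<rparr>"

text \<open>The summand \<open>F\<close> is left general so that the splitting serves both the
  vector-valued stationarity equation and the real-valued Lagrangian.\<close>

lemma sum_gamM_M_mult_of_T_mult:
  fixes x y :: "real^'n::finite" and F :: "'n \<Rightarrow> real \<Rightarrow> 'a::comm_monoid_add"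
  assumes "R_feasible P h Q g s \<epsilon> x y"
  shows "(\<Sum>i\<in>I0 x. F i (gamM (M_mult_of_T_mult y M) i)) =
         (\<Sum>i\<in>a01 x y. F i (sig1 M i)) + (\<Sum>i\<in>a00 x y. F i (rho1 M i))"
  unfolding I0_eq_a01_Un_a00[OF assms]
  by (subst sum.union_disjoint)
    (auto simp: a01_Int_a00[OF assms] M_mult_of_T_mult_def a01_def a00_def
      intro!: arg_cong2[of _ _ _ _ "(+)"] sum.cong)

lemma is_M_multiplier_M_mult_of_T_mult:
  fixes x y :: "real^'n::finite"
  assumes feas: "R_feasible P h Q g s \<epsilon> x y"
    and M: "is_T_multiplier f P h Q g s c \<epsilon> x y M"
  shows "is_M_multiplier f P h Q g x (M_mult_of_T_mult y M)"
proof -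
  have "grad f x = fst (grad f x, c)" by simp
  also have "\<dots> = (\<Sum>p\<in>P. lamT M p *\<^sub>R grad (h p) x) + (\<Sum>q\<in>Q0 Q g x. mu1 M q *\<^sub>R grad (g q) x)
      + ((\<Sum>i\<in>a01 x y. sig1 M i *\<^sub>R coord i) + (\<Sum>i\<in>a00 x y. rho1 M i *\<^sub>R coord i))"
    using M unfolding is_T_multiplier_def
    by (simp only: fst_add fst_diff fst_sum fst_scaleR fst_conv scaleR_zero_right sum.neutral_const)
      (simp add: algebra_simps)
  also have "(\<Sum>i\<in>a01 x y. sig1 M i *\<^sub>R coord i) + (\<Sum>i\<in>a00 x y. rho1 M i *\<^sub>R coord i)
      = (\<Sum>i\<in>I0 x. gamM (M_mult_of_T_mult y M) i *\<^sub>R coord i)"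
    using sum_gamM_M_mult_of_T_mult[OF feas, of "\<lambda>i t. t *\<^sub>R coord i" M] by simp
  finally show ?thesis
    using M by (simp add: is_M_multiplier_def is_T_multiplier_def M_mult_of_T_mult_def)
qed

section \<open>The y-part of the stationarity equation\<close>

lemma T_multiplier_snd:
  fixes x y :: "real^'n::finite"
  assumes "is_T_multiplier f P h Q g s c \<epsilon> x y M"
  shows "c $ i = mu3 M - (if i \<in> upper_active \<epsilon> y then mu2 M i else 0)
           + (if i \<in> a10 x y then sig2 M i else 0) + (if i \<in> a00 x y then rho2 M i else 0)"
proof -
  have pick: "(\<Sum>j\<in>J. t j * (coord j :: real^'n) $ i) = (if i \<in> J then t i else 0)"
    for J :: "'n set" and t
    by (simp add: axis_def if_distrib[of "(*) _"] cong: if_cong)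
  have "c = snd (grad f x, c)" by simp
  also have "\<dots> = - (\<Sum>i\<in>upper_active \<epsilon> y. mu2 M i *\<^sub>R coord i) + mu3 M *\<^sub>R 1
      + (\<Sum>i\<in>a10 x y. sig2 M i *\<^sub>R coord i) + (\<Sum>i\<in>a00 x y. rho2 M i *\<^sub>R coord i)"
    using assms unfolding is_T_multiplier_def
    by (simp only: snd_add snd_diff snd_sum snd_scaleR snd_conv scaleR_zero_right sum.neutral_const)
      simp
  finally show ?thesis
    by (simp add: pick)
qed

text \<open>The multiplier is an arbitrary one, so the results below need no constraint
  qualification; the main proof inserts the one chosen by \<open>T_multiplier\<close>.\<close>

locale T_point =
  fixes f :: "real^'n::finite \<Rightarrow> real"
    and P :: "'p set" and h :: "'p \<Rightarrow> real^'n \<Rightarrow> real"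
    and Q :: "'q set" and g :: "'q \<Rightarrow> real^'n \<Rightarrow> real"
    and s :: nat and c :: "real^'n" and \<epsilon> :: real and x y :: "real^'n"
    and M :: "('p, 'q, 'n) T_mult"
  assumes s_less: "s < CARD('n)"
    and c_pos: "c $ i > 0" and c_distinct: "i \<noteq> j \<Longrightarrow> c $ i \<noteq> c $ j"
    and eps: "0 < \<epsilon>" "\<epsilon> \<le> 1 / (real CARD('n) - real s)"
    and feas: "R_feasible P h Q g s \<epsilon> x y"
    and mult: "is_T_multiplier f P h Q g s c \<epsilon> x y M"
begin

lemma c_a01:
  assumes "i \<in> a01 x y"
  shows "c $ i = mu3 M - (if i \<in> upper_active \<epsilon> y then mu2 M i else 0)"
  using T_multiplier_snd[OF mult, of i] assms a01_Int_a00[OF feas] a10_Un_a00[OF feas]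
  by (auto split: if_splits)

text \<open>Since n - s > 0, the set \<open>a01\<close> is nonempty, and at any of its indices the
  positive component of c is at most \<open>mu3 M\<close>.\<close>

lemma mu3_pos: "mu3 M > 0"
proof -
  have "a01 x y \<noteq> {}"
    using card_a01_ge[OF feas s_less eps] s_less by auto
  then obtain i where i: "i \<in> a01 x y"
    by blast
  moreover have "i \<in> upper_active \<epsilon> y \<Longrightarrow> mu2 M i \<ge> 0"
    using mult by (auto simp: is_T_multiplier_def)
  ultimately show ?thesis
    using c_a01[OF i] c_pos[of i] by (auto split: if_splits)
qed

lemma sum_slack_eq_0: "sum_slack s y = 0"
  using mult mu3_pos by (auto simp: is_T_multiplier_def)

lemma a01_structure:
  obtains j where "a01 x y = insert j (upper_active \<epsilon> y)" "j \<notin> upper_active \<epsilon> y"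
    and "card (a01 x y) = CARD('n) - s"
proof -
  let ?E = "upper_active \<epsilon> y" and ?d = "CARD('n) - s"
  have sub: "?E \<subseteq> a01 x y"
    using upper_active_subset_a01[OF feas] eps by blast
  have "(\<Sum>i\<in>?E. y $ i) \<le> (\<Sum>i\<in>a01 x y. y $ i)"
    using sub feas by (intro sum_mono2) (auto simp: R_feasible_def)
  then have "real (card ?E) * (1 + \<epsilon>) \<le> real ?d"
    using sum_slack_eq_0 s_less sum_a01[OF feas]
    by (simp add: upper_active_def sum_slack_def of_nat_diff)
  \<comment> \<open>As \<epsilon> > 0, a nonempty \<open>?E\<close> satisfies the preceding bound
    only with fewer than n - s elements; an empty one does so because n - s > 0.\<close>
  moreover have "real (card ?E) * \<epsilon> > 0" if "card ?E > 0"
    using that eps by simp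
  ultimately have "card ?E < ?d"
    using s_less by (cases "card ?E = 0") (auto simp: algebra_simps)
  then have "card ?E < card (a01 x y)"
    using card_a01_ge[OF feas s_less eps] by linarith
  then have "a01 x y \<noteq> ?E"
    by auto
  with sub obtain j where j: "j \<in> a01 x y" "j \<notin> ?E"
    by blast
  \<comment> \<open>At two indices of \<open>a01\<close> off the upper bound, c takes the same value
    \<open>mu3 M\<close>, so distinctness identifies them.\<close>
  have "i = j" if "i \<in> a01 x y" "i \<notin> ?E" for i
    using c_a01[OF that(1)] c_a01[OF j(1)] that(2) j(2) c_distinct[of i j] by auto
  with sub j have eq: "a01 x y = insert j ?E"
    by blast
  moreover have "card (a01 x y) = ?d"
  proof (rule antisym)
    show "card (a01 x y) \<le> ?d"
      unfolding eq using \<open>card ?E < ?d\<close> j(2) by simp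
  qed (rule card_a01_ge[OF feas s_less eps])
  ultimately show ?thesis
    using that j(2) by blast
qed

text \<open>Splitting the zero set of x into \<open>a01\<close>, of size n - s, and
  \<open>a00\<close> yields the count. Thus the biactive part of the T-index equals the sparsity
  part of the M-index.\<close>

lemma card_a00: "card (a00 x y) = s - zero_norm x"
proof -
  obtain j where "card (a01 x y) = CARD('n) - s"
    using a01_structure by blast
  moreover have "card (I0 x) = card (a01 x y) + card (a00 x y)"
    using a01_Int_a00[OF feas] I0_eq_a01_Un_a00[OF feas] by (simp add: card_Un_disjoint)
  ultimately show ?thesis
    using card_I0_plus_zero_norm[of x] s_less by linarith
qed

lemma T_tangent_eq: "T_tangent P h Q g s \<epsilon> x y = (\<lambda>v. (v, 0)) ` M_tangent P h Q g x"
proof -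
  obtain j where j: "a01 x y = insert j (upper_active \<epsilon> y)" "j \<notin> upper_active \<epsilon> y"
    using a01_structure by blast
  \<comment> \<open>All components except the one at \<open>j\<close> vanish individually; the
    linearized cardinality constraint, which is active, then forces this last one to be 0.\<close>
  have "\<eta> = 0" if "\<forall>i\<in>upper_active \<epsilon> y. \<eta> $ i = 0" "(\<Sum>i\<in>UNIV. \<eta> $ i) = 0"
    "\<forall>i\<in>a00 x y \<union> a10 x y. \<eta> $ i = 0" for \<eta> :: "real^'n"
  proof -
    have off_j: "\<eta> $ i = 0" if "i \<noteq> j" for i
      using \<open>\<forall>i\<in>upper_active \<epsilon> y. \<eta> $ i = 0\<close> \<open>\<forall>i\<in>a00 x y \<union> a10 x y. \<eta> $ i = 0\<close> that
        a10_Un_a00[OF feas] j by auto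
    then have "(\<Sum>i\<in>UNIV. \<eta> $ i) = \<eta> $ j"
      by (subst sum.remove[of _ j]) auto
    then show ?thesis
      using off_j that(2) by (simp add: Finite_Cartesian_Product.vec_eq_iff) metis
  qed
  then show ?thesis
    using I0_eq_a01_Un_a00[OF feas] sum_slack_eq_0
    by (auto simp: T_tangent_def M_tangent_def Un_commute)
qed

end

section \<open>Multipliers and Lagrangians\<close>

text \<open>Under the embedding of v as \<open>(v, 0)\<close> the CC-LICQ gradients form a subfamily
  of the MPOC-LICQ gradients; \<open>k\<close> is the corresponding renaming of indices.\<close>

lemma CC_LICQ_if_MPOC_LICQ:
  fixes x y :: "real^'n::finite"
  assumes feas: "R_feasible P h Q g s \<epsilon> x y" and licq: "MPOC_LICQ P h Q g s \<epsilon> x y"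
  shows "CC_LICQ P h Q g x"
proof -
  let ?I = "CC_h ` P \<union> CC_g ` Q0 Q g x \<union> CC_x ` I0 x :: ('a, 'b, 'n) cc_index set"
  define k :: "('a, 'b, 'n) cc_index \<Rightarrow> ('a, 'b, 'n) mpoc_index"
    where "k = case_cc_index MPOC_h MPOC_g MPOC_x"
  have "k ` ?I = MPOC_h ` P \<union> MPOC_g ` Q0 Q g x \<union> MPOC_x ` (a01 x y \<union> a00 x y)"
    by (auto simp: k_def image_Un image_image I0_eq_a01_Un_a00[OF feas])
  then have "lin_indep_family (mpoc_gradient h g x) (k ` ?I)"
    using licq unfolding MPOC_LICQ_def by (elim lin_indep_family_subset) auto
  moreover have "inj_on k ?I"
    by (auto simp: inj_on_def k_def split: cc_index.splits)
  ultimately have "lin_indep_family (\<lambda>i. mpoc_gradient h g x (k i)) ?I"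
    by (rule lin_indep_family_reindex)
  also have "(\<lambda>i. mpoc_gradient h g x (k i)) = (\<lambda>i. (cc_gradient h g x i, 0))"
    by (rule ext) (auto simp: k_def split: cc_index.splits)
  finally show ?thesis
    unfolding CC_LICQ_def by (rule lin_indep_family_linear_preimage[OF linear_Pair_zero])
qed

text \<open>This links the multiplier fixed by Hilbert choice in \<open>M_multiplier\<close> with
  the one inherited from the reformulation.\<close>

lemma M_multiplier_unique:
  fixes x :: "real^'n::finite"
  assumes licq: "CC_LICQ P h Q g x" and "finite P" "finite Q"
    and M: "is_M_multiplier f P h Q g x M" and N: "is_M_multiplier f P h Q g x N"
  shows "p \<in> P \<Longrightarrow> lamM M p = lamM N p"
    and "q \<in> Q0 Q g x \<Longrightarrow> muM M q = muM N q"
    and "i \<in> I0 x \<Longrightarrow> gamM M i = gamM N i"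
proof -
  let ?I = "CC_h ` P \<union> CC_g ` Q0 Q g x \<union> CC_x ` I0 x :: ('a, 'b, 'n) cc_index set"
  let ?coeff = "\<lambda>M. case_cc_index (lamM M) (muM M) (gamM M)"
  have finQ: "finite (Q0 Q g x)"
    using \<open>finite Q\<close> by (simp add: Q0_def)
  have "grad f x = (\<Sum>k\<in>?I. ?coeff M k *\<^sub>R cc_gradient h g x k)"
    if "is_M_multiplier f P h Q g x M" for M
  proof -
    have "(\<Sum>k\<in>?I. ?coeff M k *\<^sub>R cc_gradient h g x k) =
        (\<Sum>k\<in>CC_h ` P. ?coeff M k *\<^sub>R cc_gradient h g x k)
        + (\<Sum>k\<in>CC_g ` Q0 Q g x. ?coeff M k *\<^sub>R cc_gradient h g x k)
        + (\<Sum>k\<in>CC_x ` I0 x. ?coeff M k *\<^sub>R cc_gradient h g x k)"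
      \<comment> \<open>Images of different constructors are disjoint, so the sum over the tagged
        index set splits into the three sums of the stationarity equation.\<close>
      using \<open>finite P\<close> finQ by (subst sum.union_disjoint; auto)+
    also have "\<dots> = grad f x"
      using that by (simp add: is_M_multiplier_def sum.reindex inj_on_def)
    finally show ?thesis ..
  qed
  from this[OF M] this[OF N] have "?coeff M k = ?coeff N k" if "k \<in> ?I" for k
    using licq \<open>finite P\<close> finQ that unfolding CC_LICQ_def
    by (intro lin_indep_family_coeff_unique[where v = "cc_gradient h g x" and I = ?I]) auto
  from this[of "CC_h p"] this[of "CC_g q"] this[of "CC_x i"]
  show "p \<in> P \<Longrightarrow> lamM M p = lamM N p" and "q \<in> Q0 Q g x \<Longrightarrow> muM M q = muM N q"
    and "i \<in> I0 x \<Longrightarrow> gamM M i = gamM N i"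
    by auto
qed

lemma M_lagrangian_cong:
  assumes "\<And>p. p \<in> P \<Longrightarrow> lamM M p = lamM N p"
    and "\<And>q. q \<in> Q0 Q g x \<Longrightarrow> muM M q = muM N q"
    and "\<And>i. i \<in> I0 x \<Longrightarrow> gamM M i = gamM N i"
  shows "M_lagrangian f P h Q g x M = M_lagrangian f P h Q g x N"
  using assms by (auto simp: M_lagrangian_def fun_eq_iff cong: sum.cong)

lemma M_lagrangian_differentiable:
  fixes f :: "real^'n::finite \<Rightarrow> real"
  assumes "C2 f" "\<And>p. p \<in> P \<Longrightarrow> C2 (h p)" "\<And>q. q \<in> Q \<Longrightarrow> C2 (g q)"
  shows "M_lagrangian f P h Q g xb M differentiable (at z)"
    and "grad (M_lagrangian f P h Q g xb M) differentiable (at z)"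
proof -
  have C2D: "(F has_derivative (\<lambda>k. inner k (grad F z))) (at z)"
    "(grad F has_derivative hess F z) (at z)" if "C2 F" for F :: "real^'n \<Rightarrow> real" and z
    using that GDERIV_grad[of F z]
    by (auto simp: C2_def gderiv_def hess_def frechet_derivative_works)
  have g: "C2 (g q)" if "q \<in> Q0 Q g xb" for q
    using that assms(3) by (simp add: Q0_def)
  note D = C2D[OF assms(1)] C2D[OF assms(2)] C2D[OF g]
  have G: "GDERIV (M_lagrangian f P h Q g xb M) z :> grad f z
        - (\<Sum>p\<in>P. lamM M p *\<^sub>R grad (h p) z)
        - (\<Sum>q\<in>Q0 Q g xb. muM M q *\<^sub>R grad (g q) z)
        - (\<Sum>i\<in>I0 xb. gamM M i *\<^sub>R coord i)" for z
    unfolding gderiv_def M_lagrangian_def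
    by (auto intro!: derivative_eq_intros D bounded_linear_imp_has_derivative bounded_linear_vec_nth
        simp: inner_diff_right inner_sum_right inner_axis)
  then show "M_lagrangian f P h Q g xb M differentiable (at z)"
    unfolding gderiv_def differentiable_def by blast
  have "((\<lambda>z. grad f z - (\<Sum>p\<in>P. lamM M p *\<^sub>R grad (h p) z)
        - (\<Sum>q\<in>Q0 Q g xb. muM M q *\<^sub>R grad (g q) z) - (\<Sum>i\<in>I0 xb. gamM M i *\<^sub>R coord i))
      has_derivative (\<lambda>k. hess f z k - (\<Sum>p\<in>P. lamM M p *\<^sub>R hess (h p) z k)
        - (\<Sum>q\<in>Q0 Q g xb. muM M q *\<^sub>R hess (g q) z k))) (at z)"
    by (auto intro!: derivative_eq_intros D)
  \<comment> \<open>The gradient formula holds at every point, hence as an equality of functions,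
    which can be differentiated again.\<close>
  then show "grad (M_lagrangian f P h Q g xb M) differentiable (at z)"
    unfolding differentiable_def ext[OF grad_eqI[OF G]] by blast
qed

lemma T_lagrangian_eq_M_lagrangian_add_affine:
  fixes x y :: "real^'n::finite"
  assumes feas: "R_feasible P h Q g s \<epsilon> x y"
  obtains a b where "T_lagrangian f P h Q g s c \<epsilon> x y M =
    (\<lambda>(z, w). M_lagrangian f P h Q g x (M_mult_of_T_mult y M) z + (inner a w + b))"
proof
  \<comment> \<open>\<open>?a\<close> collects the coefficients of w and \<open>?b\<close> the
    constants from the upper bounds and the cardinality constraint. The all-ones vector is written
    as the sum of the \<open>coord i\<close> so that the inner product expands
    componentwise.\<close>
  let ?a = "c + (\<Sum>i\<in>upper_active \<epsilon> y. mu2 M i *\<^sub>R coord i) - mu3 M *\<^sub>R (\<Sum>i\<in>UNIV. coord i)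
    - (\<Sum>i\<in>a10 x y. sig2 M i *\<^sub>R coord i) - (\<Sum>i\<in>a00 x y. rho2 M i *\<^sub>R coord i)"
  let ?b = "mu3 M * (real CARD('n) - real s) - (\<Sum>i\<in>upper_active \<epsilon> y. mu2 M i * (1 + \<epsilon>))"
  show "T_lagrangian f P h Q g s c \<epsilon> x y M =
    (\<lambda>(z, w). M_lagrangian f P h Q g x (M_mult_of_T_mult y M) z + (inner ?a w + ?b))"
  proof (rule ext, clarify)
    fix z w :: "real^'n"
    have "(\<Sum>i\<in>I0 x. gamM (M_mult_of_T_mult y M) i * z $ i) =
        (\<Sum>i\<in>a01 x y. sig1 M i * z $ i) + (\<Sum>i\<in>a00 x y. rho1 M i * z $ i)"
      using sum_gamM_M_mult_of_T_mult[OF feas, of "\<lambda>i t. t * z $ i" M] by simp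
    then show "T_lagrangian f P h Q g s c \<epsilon> x y M (z, w) =
        M_lagrangian f P h Q g x (M_mult_of_T_mult y M) z + (inner ?a w + ?b)"
      by (simp add: T_lagrangian_def M_lagrangian_def M_mult_of_T_mult_def sum_slack_def
          inner_add_left inner_diff_left inner_sum_left inner_axis' algebra_simps
          sum.distrib sum_subtractf sum_distrib_left)
  qed
qed

section \<open>Transfer of stationarity, nondegeneracy and index\<close>

theorem theorem3:
  fixes f :: "real^'n::finite \<Rightarrow> real"
    and P :: "'p set" and h :: "'p \<Rightarrow> real^'n \<Rightarrow> real"
    and Q :: "'q set" and g :: "'q \<Rightarrow> real^'n \<Rightarrow> real"
    and s :: nat and c :: "real^'n" and \<epsilon> :: real and x y :: "real^'n"
  assumes "s < CARD('n)"
    and "finite P" and "finite Q"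
    and "C2 f" and "\<And>p. p \<in> P \<Longrightarrow> C2 (h p)" and "\<And>q. q \<in> Q \<Longrightarrow> C2 (g q)"
    and "\<And>i. c $ i > 0" and "\<And>i j. i \<noteq> j \<Longrightarrow> c $ i \<noteq> c $ j"
    and "0 < \<epsilon>" and "\<epsilon> \<le> 1 / (real CARD('n) - real s)"
    and "T_stationary f P h Q g s c \<epsilon> x y"
  shows "M_stationary f P h Q g s x \<and>
         (\<forall>m. T_nondegenerate f P h Q g s c \<epsilon> x y \<and> T_index f P h Q g s c \<epsilon> x y = m \<and>
              NDT5 f P h Q g s c \<epsilon> x y \<longrightarrow>
              M_nondegenerate f P h Q g s x \<and> M_index f P h Q g s x = m)"
proof -
  let ?M = "T_multiplier f P h Q g s c \<epsilon> x y" and ?N = "M_multiplier f P h Q g x"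
  let ?N' = "M_mult_of_T_mult y ?M"
  have feas: "R_feasible P h Q g s \<epsilon> x y" and M: "is_T_multiplier f P h Q g s c \<epsilon> x y ?M"
    using assms(11) someI_ex[of "is_T_multiplier f P h Q g s c \<epsilon> x y"]
    by (auto simp: T_stationary_def T_multiplier_def)
  interpret T_point f P h Q g s c \<epsilon> x y ?M
    by unfold_locales (use assms feas M in auto)
  have N': "is_M_multiplier f P h Q g x ?N'"
    by (rule is_M_multiplier_M_mult_of_T_mult[OF feas M])
  then have N: "is_M_multiplier f P h Q g x ?N"
    unfolding M_multiplier_def by (rule someI)
  have stat: "M_stationary f P h Q g s x"
    using CCOP_feasible_if_R_feasible[OF feas] assms(1,9,10) N by (auto simp: M_stationary_def)
  moreover have "M_nondegenerate f P h Q g s x \<and>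
      M_index f P h Q g s x = T_index f P h Q g s c \<epsilon> x y"
    if nd: "T_nondegenerate f P h Q g s c \<epsilon> x y" and ndt5: "NDT5 f P h Q g s c \<epsilon> x y"
  proof -
    have licq: "CC_LICQ P h Q g x"
      using nd CC_LICQ_if_MPOC_LICQ[OF feas] by (simp add: T_nondegenerate_def Let_def)
    note unique = M_multiplier_unique[OF licq assms(2,3) N N']
    have mu: "\<forall>q\<in>Q0 Q g x. muM ?N q > 0"
      using nd unique(2) by (simp add: T_nondegenerate_def Let_def M_mult_of_T_mult_def)
    have gam: "\<forall>i\<in>I0 x. gamM ?N i \<noteq> 0" if "zero_norm x < s"
    proof
      fix i assume i: "i \<in> I0 x"
      \<comment> \<open>If the sparsity bound is slack, the count of \<open>a00\<close> is positive.
        This triggers NDT5, which covers \<open>a01\<close>; NDT3 covers \<open>a00\<close>.\<close>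
      have "a00 x y \<noteq> {}"
        using card_a00 that by auto
      then have "\<forall>i\<in>a01 x y. sig1 ?M i \<noteq> 0"
        using ndt5 by (simp add: NDT5_def)
      moreover have "\<forall>i\<in>a00 x y. rho1 ?M i \<noteq> 0"
        using nd by (simp add: T_nondegenerate_def Let_def)
      ultimately show "gamM ?N i \<noteq> 0"
        using unique(3)[OF i] i I0_eq_a01_Un_a00[OF feas]
        by (auto simp: M_mult_of_T_mult_def a01_def a00_def)
    qed
    obtain a b where "T_lagrangian f P h Q g s c \<epsilon> x y ?M =
        (\<lambda>(z, w). M_lagrangian f P h Q g x ?N' z + (inner a w + b))"
      using T_lagrangian_eq_M_lagrangian_add_affine[OF feas] by blast
    \<comment> \<open>The chosen and the inherited multiplier may differ off the active sets, but
      the Lagrangian only sees their values on these sets.\<close>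
    also have "M_lagrangian f P h Q g x ?N' = M_lagrangian f P h Q g x ?N"
      using unique by (intro M_lagrangian_cong) auto
    finally have "T_hessian f P h Q g s c \<epsilon> x y (v, w) = (M_hessian f P h Q g x v, 0)" for v w
      unfolding T_hessian_def M_hessian_def
      by (simp only:) (intro hess_add_affine_snd M_lagrangian_differentiable assms(4-6))
    note hessian = this[of _ 0]
    have "nonsingular_on (M_hessian f P h Q g x) (M_tangent P h Q g x)"
      using nd nonsingular_on_Pair_zero[of "T_hessian f P h Q g s c \<epsilon> x y", OF hessian]
        T_tangent_eq
      by (simp add: T_nondegenerate_def Let_def)
    then have "M_nondegenerate f P h Q g s x"
      using stat licq mu gam by (simp add: M_nondegenerate_def Let_def)
    moreover have "M_index f P h Q g s x = T_index f P h Q g s c \<epsilon> x y"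
      using quadratic_index_Pair_zero[of "T_hessian f P h Q g s c \<epsilon> x y", OF hessian]
        T_tangent_eq card_a00
      by (simp add: M_index_def T_index_def)
    ultimately show ?thesis ..
  qed
  ultimately show ?thesis
    by blast
qed

end
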